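(* Let $J\subseteq\mathbb{R}$ be a nonempty open interval. Assume that $G,H:J\to\mathbb{R}$ are differentiable functions such that $0\notin H'(J)$ and $\frac{G'}{H'}$ is invertible (i.e. injective) on $J$, and that $\Phi:J\to\mathbb{R}$ is continuous and strictly monotone. Then $$\mathrm{C}_{G,H}(x,y)=\mathrm{A}_\Phi(x,y)\qquad\text{for all }x,y\in J$$ holds if and only if $\Phi$ is differentiable with a nonvanishing first derivative and there exist constants $A,B,C,D\in\mathbb{R}$ with $AD\neq BC$ and $\mu,\lambda,\gamma\in\mathbb{R}$ such that $$\begin{pmatrix}G\\H\end{pmatrix}=\begin{pmatrix}A&B\\C&D\end{pmatrix}\begin{pmatrix}\psi_1\\\psi_2\end{pmatrix}+\begin{pmatrix}\mu\\\lambda\end{pmatrix}$$ holds on $J$, where, for $x\in J$, $$(\psi_1(x),\psi_2(x))=\begin{cases}\big(\cos(\sqrt{-\gamma}\,\Phi(x)),\ \sin(\sqrt{-\gamma}\,\Phi(x))\big)&\text{if }\gamma<0,\\ \big(\Phi(x)^2,\ \Phi(x)\big)&\text{if }\gamma=0,\\ \big(\cosh(\sqrt{\gamma}\,\Phi(x)),\ \sinh(\sqrt{\gamma}\,\Phi(x))\big)&\text{if }\gamma>0.\end{cases}$$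
   Context: For differentiable $G,H:J\to\mathbb{R}$ with $0\notin H'(J)$ and $G'/H'$ invertible on $J$ (as a map onto its range), the two-variable Cauchy mean $\mathrm{C}_{G,H}:J\times J\to\mathbb{R}$ is defined by $$\mathrm{C}_{G,H}(x,y)=\Big(\frac{G'}{H'}\Big)^{-1}\Big(\frac{G(x)-G(y)}{H(x)-H(y)}\Big)\ \text{ if }x\neq y,\qquad \mathrm{C}_{G,H}(x,x)=x.$$ (It is well defined by the Cauchy Mean Value Theorem.) For a continuous strictly monotone $\Phi:J\to\mathbb{R}$, the two-variable quasi-arithmetic mean is $$\mathrm{A}_\Phi(x,y)=\Phi^{-1}\Big(\frac{\Phi(x)+\Phi(y)}{2}\Big),\qquad x,y\in J.$$ *)

theory Defs
  imports "HOL-Analysis.Analysis"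
begin

text \<open>
  Functions on an interval \<open>J\<close> are represented by total functions \<open>real \<Rightarrow> real\<close>; inverses are
  taken with respect to the restriction to \<open>J\<close>. By the Cauchy mean value theorem and the
  intermediate value theorem, the arguments of \<open>inv_into\<close> below lie in the image of \<open>J\<close>
  whenever \<open>x, y \<in> J\<close> and the usual assumptions on \<open>G\<close>, \<open>H\<close> and \<open>\<Phi>\<close> hold. Since \<open>J\<close> is open
  there, \<open>deriv\<close> depends only on the values on \<open>J\<close>.
\<close>

definition cauchy_mean ::
  "real set \<Rightarrow> (real \<Rightarrow> real) \<Rightarrow> (real \<Rightarrow> real) \<Rightarrow> real \<Rightarrow> real \<Rightarrow> real" where
  "cauchy_mean J G H x y =
     (if x = y then x
      else inv_into J (\<lambda>t. deriv G t / deriv H t) ((G x - G y) / (H x - H y)))"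

definition quasi_arith_mean :: "real set \<Rightarrow> (real \<Rightarrow> real) \<Rightarrow> real \<Rightarrow> real \<Rightarrow> real" where
  "quasi_arith_mean J \<Phi> x y = inv_into J \<Phi> ((\<Phi> x + \<Phi> y) / 2)"

definition psi1 :: "real \<Rightarrow> (real \<Rightarrow> real) \<Rightarrow> real \<Rightarrow> real" where
  "psi1 \<gamma> \<Phi> x =
     (if \<gamma> < 0 then cos (sqrt (- \<gamma>) * \<Phi> x)
      else if \<gamma> = 0 then (\<Phi> x)\<^sup>2
      else cosh (sqrt \<gamma> * \<Phi> x))"

definition psi2 :: "real \<Rightarrow> (real \<Rightarrow> real) \<Rightarrow> real \<Rightarrow> real" where
  "psi2 \<gamma> \<Phi> x =
     (if \<gamma> < 0 then sin (sqrt (- \<gamma>) * \<Phi> x)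
      else if \<gamma> = 0 then \<Phi> x
      else sinh (sqrt \<gamma> * \<Phi> x))"

end

theory Submission
  imports Defs
begin

text \<open>
  With \<open>p = H \<circ> \<Phi>\<^sup>-\<^sup>1\<close>, \<open>q = G \<circ> \<Phi>\<^sup>-\<^sup>1\<close> and \<open>k = (G' / H') \<circ> \<Phi>\<^sup>-\<^sup>1\<close> on \<open>I = \<Phi>(J)\<close>, equality of the
  means says \<open>q s - q t = k ((s + t) / 2) (p s - p t)\<close>. A priori \<open>p\<close> and \<open>q\<close> are only continuous,
  but integrating over \<open>s - t\<close> for a fixed midpoint shows that \<open>k\<close> is differentiable, and a three
  point elimination transfers this to \<open>p\<close> and \<open>q\<close>. For \<open>w = p'\<close> the equation implies that both
  \<open>(p (s + a) - p (s - a)) / w s\<close> and \<open>(w (s + a) + w (s - a)) / w s\<close> are independent of \<open>s\<close>, and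
  similarly for \<open>v = q'\<close> with the same constants. Hence \<open>w\<close> and \<open>v\<close> solve one linear equation
  \<open>y'' = \<gamma> y\<close>, whose solutions are spanned by the derivatives of \<open>\<psi>\<^sub>1\<close> and \<open>\<psi>\<^sub>2\<close>. As \<open>w\<close> has no zero,
  \<open>H = p \<circ> \<Phi>\<close> makes \<open>\<Phi>\<close> differentiable. Conversely \<open>\<psi>\<^sub>i s - \<psi>\<^sub>i t\<close> is \<open>\<psi>\<^sub>i' ((s + t) / 2)\<close> times
  a factor that does not depend on \<open>i\<close>.
\<close>

section \<open>Antiderivatives and derivatives of reflected and shifted functions\<close>

lemma antiderivative_ball:
  fixes f :: "real \<Rightarrow> real"
  assumes "continuous_on (cball c r) f"
  obtains F where "\<And>x. x \<in> ball c r \<Longrightarrow> (F has_real_derivative f x) (at x)"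
proof -
  have "continuous_on {c - r..c + r} f"
    using assms by (simp add: cball_eq_atLeastAtMost)
  then obtain F where F: "\<And>x. x \<in> {c - r..c + r} \<Longrightarrow>
      (F has_vector_derivative f x) (at x within {c - r..c + r})"
    by (rule antiderivative_continuous) (rule that)
  have "(F has_real_derivative f x) (at x)" if "x \<in> ball c r" for x
  proof -
    have x: "x \<in> {c - r<..<c + r}"
      using that by (simp add: ball_eq_greaterThanLessThan)
    then have "(F has_vector_derivative f x) (at x within {c - r<..<c + r})"
      by (intro has_vector_derivative_within_subset[OF F]) auto
    then have "(F has_vector_derivative f x) (at x)"
      by (rule has_vector_derivative_within_open[OF x open_greaterThanLessThan, THEN iffD1])
    then show ?thesis
      by (simp only: has_real_derivative_iff_has_vector_derivative)
  qed
  then show thesis by (rule that)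
qed

lemma reflected_difference_deriv:
  fixes f f' :: "real \<Rightarrow> real"
  assumes "\<And>x. x \<in> S \<Longrightarrow> (f has_real_derivative f' x) (at x)" "m + h \<in> S" "m - h \<in> S"
  shows "((\<lambda>h. f (m + h) - f (m - h)) has_real_derivative f' (m + h) + f' (m - h)) (at h)"
    and "((\<lambda>h. f (m + h) + f (m - h)) has_real_derivative f' (m + h) - f' (m - h)) (at h)"
proof -
  have 1: "((\<lambda>h. f (m + h)) has_real_derivative f' (m + h) * 1) (at h)"
    by (rule DERIV_chain2[where g = "\<lambda>h. m + h", OF assms(1)[OF assms(2)]]) (auto intro!: derivative_eq_intros)
  have 2: "((\<lambda>h. f (m - h)) has_real_derivative f' (m - h) * (-1)) (at h)"
    by (rule DERIV_chain2[where g = "\<lambda>h. m - h", OF assms(1)[OF assms(3)]]) (auto intro!: derivative_eq_intros)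
  show "((\<lambda>h. f (m + h) - f (m - h)) has_real_derivative f' (m + h) + f' (m - h)) (at h)"
    using DERIV_diff[OF 1 2] by simp
  show "((\<lambda>h. f (m + h) + f (m - h)) has_real_derivative f' (m + h) - f' (m - h)) (at h)"
    using DERIV_add[OF 1 2] by simp
qed

lemma shift_deriv:
  fixes f f' :: "real \<Rightarrow> real"
  assumes "\<And>x. x \<in> S \<Longrightarrow> (f has_real_derivative f' x) (at x)" "x + a \<in> S" "x - a \<in> S"
  shows "((\<lambda>x. (f (x + a) - f (x - a)) / L) has_real_derivative (f' (x + a) - f' (x - a)) / L) (at x)"
proof -
  have 1: "((\<lambda>x. f (x + a)) has_real_derivative f' (x + a) * 1) (at x)"
    by (rule DERIV_chain2[where g = "\<lambda>x. x + a", OF assms(1)[OF assms(2)]]) (auto intro!: derivative_eq_intros)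
  have 2: "((\<lambda>x. f (x - a)) has_real_derivative f' (x - a) * 1) (at x)"
    by (rule DERIV_chain2[where g = "\<lambda>x. x - a", OF assms(1)[OF assms(3)]]) (auto intro!: derivative_eq_intros)
  show ?thesis
    using DERIV_cdivide[OF DERIV_diff[OF 1 2], of L] by simp
qed

lemma open_symmetric_shift:
  fixes I :: "real set"
  assumes "open I"
  shows "open {s. s + a \<in> I \<and> s - a \<in> I}"
proof -
  have "open ((\<lambda>s. s + a) -` I)" "open ((\<lambda>s. s - a) -` I)"
    by (auto intro!: open_vimage assms continuous_intros)
  then show ?thesis
    by (auto simp: vimage_def Collect_conj_eq)
qed

text \<open>The first relation writes \<open>f\<close> as a difference quotient of \<open>F\<close>,
  so \<open>f\<close> is differentiable and \<open>f'\<close> is the same quotient of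
  \<open>f\<close>. A second pass turns \<open>f''\<close> into
  \<open>(f (s + 2 * a) - 2 * f s + f (s - 2 * a)) / L\<^sup>2\<close>, and the second relation
  reduces this to a multiple of \<open>f s\<close>.\<close>

lemma two_step_second_derivative:
  fixes F f :: "real \<Rightarrow> real"
  assumes I: "open I" "is_interval I"
    and F: "\<And>s. s \<in> I \<Longrightarrow> (F has_real_derivative f s) (at s)"
    and one: "\<And>s. s + a \<in> I \<Longrightarrow> s - a \<in> I \<Longrightarrow> F (s + a) - F (s - a) = L * f s"
    and two: "\<And>s. s + 2 * a \<in> I \<Longrightarrow> s - 2 * a \<in> I \<Longrightarrow> f (s + 2 * a) + f (s - 2 * a) = l * f s"
    and L: "L \<noteq> 0" and a: "a > 0"
    and s: "s + 2 * a \<in> I" "s - 2 * a \<in> I"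
  shows "f differentiable at s"
    and "(deriv f has_real_derivative (l - 2) / L\<^sup>2 * f s) (at s)"
proof -
  have sub: "x \<in> I" if "y \<in> I" "z \<in> I" "y \<le> x" "x \<le> z" for x y z
    using I(2) that by (meson mem_is_interval_1_I)
  have f_deriv: "(f has_real_derivative (f (x + a) - f (x - a)) / L) (at x)"
    if "x + a \<in> I" "x - a \<in> I" for x
  proof (rule has_field_derivative_transform_within_open)
    show "((\<lambda>x. (F (x + a) - F (x - a)) / L) has_real_derivative (f (x + a) - f (x - a)) / L) (at x)"
      by (rule shift_deriv[OF F]) (use that in auto)
    show "open {s. s + a \<in> I \<and> s - a \<in> I}"
      by (rule open_symmetric_shift[OF I(1)])
  qed (use that one L in auto)
  have near: "s \<in> {s. s + a \<in> I \<and> s - a \<in> I}" "s \<in> I"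
    using a s sub[of "s - 2 * a" "s + 2 * a"] by auto
  then show "f differentiable at s"
    using f_deriv real_differentiable_def by blast
  show "(deriv f has_real_derivative (l - 2) / L\<^sup>2 * f s) (at s)"
  proof (rule has_field_derivative_transform_within_open)
    have "((\<lambda>x. (f (x + a) - f (x - a)) / L) has_real_derivative
        ((f (s + a + a) - f (s + a - a)) / L - (f (s - a + a) - f (s - a - a)) / L) / L) (at s)"
      by (rule shift_deriv[where S = "{s. s + a \<in> I \<and> s - a \<in> I}"])
        (use f_deriv s near in \<open>auto simp: algebra_simps\<close>)
    moreover have "((f (s + a + a) - f (s + a - a)) / L - (f (s - a + a) - f (s - a - a)) / L) / L
        = (f (s + 2 * a) + f (s - 2 * a) - 2 * f s) / L\<^sup>2"
      using L by (simp add: field_simps power2_eq_square)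
    moreover have "\<dots> = (l - 2) / L\<^sup>2 * f s"
      by (simp add: two[OF s] left_diff_distrib)
    ultimately show "((\<lambda>x. (f (x + a) - f (x - a)) / L) has_real_derivative
        (l - 2) / L\<^sup>2 * f s) (at s)"
      by simp
    show "open {s. s + a \<in> I \<and> s - a \<in> I}"
      by (rule open_symmetric_shift[OF I(1)])
  qed (use near f_deriv in \<open>auto intro!: DERIV_imp_deriv[symmetric]\<close>)
qed

section \<open>Solutions of \<open>y'' = c y\<close> and the functions \<open>psi1\<close>,
  \<open>psi2\<close>\<close>

lemma zero_deriv_constant:
  fixes f :: "real \<Rightarrow> real"
  assumes "convex I" "\<And>s. s \<in> I \<Longrightarrow> (f has_real_derivative 0) (at s)"
  obtains c where "\<And>s. s \<in> I \<Longrightarrow> f s = c"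
  using has_field_derivative_zero_constant[of I f] assms has_field_derivative_at_within by blast

text \<open>The Wronskians of \<open>y\<close> with \<open>d2\<close> and of \<open>d1\<close> with
  \<open>y\<close> are constant because all three functions solve the same equation. Cramer's rule
  with the determinant \<open>W\<close> then recovers \<open>y\<close>.\<close>

lemma second_order_solution:
  fixes y d1 d2 :: "real \<Rightarrow> real"
  assumes "convex I"
    and y: "\<And>s. s \<in> I \<Longrightarrow> (y has_real_derivative y1 s) (at s)"
      "\<And>s. s \<in> I \<Longrightarrow> (y1 has_real_derivative c * y s) (at s)"
    and d1: "\<And>s. (d1 has_real_derivative e1 s) (at s)" "\<And>s. (e1 has_real_derivative c * d1 s) (at s)"
    and d2: "\<And>s. (d2 has_real_derivative e2 s) (at s)" "\<And>s. (e2 has_real_derivative c * d2 s) (at s)"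
    and W: "W \<noteq> 0" "\<And>s. d1 s * e2 s - d2 s * e1 s = W"
  obtains A B where "\<And>s. s \<in> I \<Longrightarrow> y s = A * d1 s + B * d2 s"
proof -
  have "((\<lambda>s. y s * e2 s - y1 s * d2 s) has_real_derivative 0) (at s)" if "s \<in> I" for s
    by (auto intro!: derivative_eq_intros y[OF that] d2 simp: algebra_simps)
  then obtain A where A: "\<And>s. s \<in> I \<Longrightarrow> y s * e2 s - y1 s * d2 s = A"
    using zero_deriv_constant[OF \<open>convex I\<close>] by blast
  have "((\<lambda>s. d1 s * y1 s - e1 s * y s) has_real_derivative 0) (at s)" if "s \<in> I" for s
    by (auto intro!: derivative_eq_intros y[OF that] d1 simp: algebra_simps)
  then obtain B where B: "\<And>s. s \<in> I \<Longrightarrow> d1 s * y1 s - e1 s * y s = B"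
    using zero_deriv_constant[OF \<open>convex I\<close>] by blast
  have "y s = A / W * d1 s + B / W * d2 s" if "s \<in> I" for s
  proof -
    have "y s * W = A * d1 s + B * d2 s"
      unfolding W(2)[of s, symmetric] A[OF that, symmetric] B[OF that, symmetric] by algebra
    then show ?thesis
      using W(1) by (simp add: field_simps)
  qed
  then show thesis by (rule that)
qed

abbreviation dpsi1 :: "real \<Rightarrow> real \<Rightarrow> real" where
  "dpsi1 c s \<equiv> (if c < 0 then - sqrt (- c) * sin (sqrt (- c) * s)
    else if c = 0 then 2 * s else sqrt c * sinh (sqrt c * s))"

abbreviation dpsi2 :: "real \<Rightarrow> real \<Rightarrow> real" where
  "dpsi2 c s \<equiv> (if c < 0 then sqrt (- c) * cos (sqrt (- c) * s)
    else if c = 0 then 1 else sqrt c * cosh (sqrt c * s))"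

text \<open>Inserting \<open>id\<close> isolates the function of one real variable; composing it
  with \<open>\<Phi>\<close> gives back \<open>psi1 c \<Phi>\<close> and
  \<open>psi2 c \<Phi>\<close>.\<close>

lemma psi_deriv:
  "(psi1 c id has_real_derivative dpsi1 c s) (at s)"
  "(psi2 c id has_real_derivative dpsi2 c s) (at s)"
  unfolding psi1_def psi2_def id_def
  by (cases c "0::real" rule: linorder_cases; auto intro!: derivative_eq_intros)+

text \<open>The derivatives, not \<open>psi1\<close> and \<open>psi2\<close> themselves, form the
  fundamental system: for \<open>c = 0\<close> the square does not solve \<open>y'' = 0\<close>,
  whereas \<open>2 * s\<close> and \<open>1\<close> do.\<close>

lemma dpsi_wronskian:
  obtains e1 e2 W where
    "\<And>s. (dpsi1 c has_real_derivative e1 s) (at s)" "\<And>s. (e1 has_real_derivative c * dpsi1 c s) (at s)"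
    "\<And>s. (dpsi2 c has_real_derivative e2 s) (at s)" "\<And>s. (e2 has_real_derivative c * dpsi2 c s) (at s)"
    "W \<noteq> 0" "\<And>s. dpsi1 c s * e2 s - dpsi2 c s * e1 s = W"
proof (cases c "0::real" rule: linorder_cases)
  case less
  define r where "r = sqrt (- c)"
  have r: "c = - (r\<^sup>2)" "r > 0"
    using less by (auto simp: r_def)
  show ?thesis
  proof (rule that[of "\<lambda>s. - (r\<^sup>2) * cos (r * s)" "\<lambda>s. - (r\<^sup>2) * sin (r * s)" "r ^ 3"])
    fix s
    have "(sin (r * s))\<^sup>2 + (cos (r * s))\<^sup>2 = 1" by simp
    moreover have "- r * sin (r * s) * (- (r\<^sup>2) * sin (r * s)) - r * cos (r * s) * (- (r\<^sup>2) * cos (r * s))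
      = r ^ 3 * ((sin (r * s))\<^sup>2 + (cos (r * s))\<^sup>2)" by algebra
    ultimately show "dpsi1 c s * (- (r\<^sup>2) * sin (r * s)) - dpsi2 c s * (- (r\<^sup>2) * cos (r * s)) = r ^ 3"
      using less by (simp add: r_def)
  qed (use less r in \<open>auto intro!: derivative_eq_intros simp: r_def[symmetric] power2_eq_square\<close>)
next
  case equal
  show ?thesis
    by (rule that[of "\<lambda>s. 2" "\<lambda>s. 0" "-2"])
      (use equal in \<open>auto intro!: derivative_eq_intros\<close>)
next
  case greater
  define r where "r = sqrt c"
  have r: "c = r\<^sup>2" "r > 0"
    using greater by (auto simp: r_def)
  show ?thesis
  proof (rule that[of "\<lambda>s. r\<^sup>2 * cosh (r * s)" "\<lambda>s. r\<^sup>2 * sinh (r * s)" "- (r ^ 3)"])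
    fix s
    have "(cosh (r * s))\<^sup>2 = (sinh (r * s))\<^sup>2 + 1" by (rule cosh_square_eq)
    then have "r * sinh (r * s) * (r\<^sup>2 * sinh (r * s)) - r * cosh (r * s) * (r\<^sup>2 * cosh (r * s)) = - (r ^ 3)"
      by algebra
    then show "dpsi1 c s * (r\<^sup>2 * sinh (r * s)) - dpsi2 c s * (r\<^sup>2 * cosh (r * s)) = - (r ^ 3)"
      using greater by (simp add: r_def)
  qed (use greater r in \<open>auto intro!: derivative_eq_intros simp: r_def[symmetric] power2_eq_square\<close>)
qed

text \<open>With midpoint \<open>m\<close> and half-difference \<open>h\<close>, the addition
  theorems separate \<open>m\<close> from \<open>h\<close>. The factor \<open>L\<close> depends on
  \<open>h\<close> and \<open>c\<close> only, and it is shared by both functions, so it cancels in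
  quotients of differences of their linear combinations.\<close>

lemma psi_symmetric_difference:
  obtains L where
    "psi1 c id s - psi1 c id t = L * dpsi1 c ((s + t) / 2)"
    "psi2 c id s - psi2 c id t = L * dpsi2 c ((s + t) / 2)"
proof -
  define m h where "m = (s + t) / 2" and "h = (s - t) / 2"
  have st: "s = m + h" "t = m - h" by (auto simp: m_def h_def field_simps)
  show thesis
  proof (cases c "0::real" rule: linorder_cases)
    case less
    then show thesis
      by (intro that[of "2 * sin (sqrt (- c) * h) / sqrt (- c)"])
        (simp_all add: psi1_def psi2_def m_def[symmetric] st distrib_left right_diff_distrib
          cos_add cos_diff sin_add sin_diff)
  next
    case equal
    then show thesis
      by (intro that[of "2 * h"])
        (simp_all add: psi1_def psi2_def m_def[symmetric] st power2_eq_square algebra_simps)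
  next
    case greater
    then show thesis
      by (intro that[of "2 * sinh (sqrt c * h) / sqrt c"])
        (simp_all add: psi1_def psi2_def m_def[symmetric] st distrib_left right_diff_distrib
          cosh_add cosh_diff sinh_add sinh_diff)
  qed
qed

section \<open>The midpoint equation and the regularity of its solutions\<close>

locale midpoint_equation =
  fixes I :: "real set" and p q k :: "real \<Rightarrow> real"
  assumes open_I: "open I" and interval_I: "is_interval I"
    and cont_p: "continuous_on I p" and cont_q: "continuous_on I q"
    and inj_p: "inj_on p I" and inj_k: "inj_on k I"
    and midpoint_eq: "\<And>s t. s \<in> I \<Longrightarrow> t \<in> I \<Longrightarrow> q s - q t = k ((s + t) / 2) * (p s - p t)"
begin

lemma mem_between: "x \<in> I" if "y \<in> I" "z \<in> I" "y \<le> x" "x \<le> z" for x y z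
  using interval_I that by (meson mem_is_interval_1_I)

lemma midpoint_mem: "s \<in> I \<Longrightarrow> t \<in> I \<Longrightarrow> (s + t) / 2 \<in> I"
  using mem_between[of s t "(s + t) / 2"] mem_between[of t s "(s + t) / 2"]
  by (cases "s \<le> t") auto

lemma k_midpoint_neq:
  assumes "s \<in> I" "t \<in> I" "r \<in> I" "t \<noteq> r"
  shows "k ((s + t) / 2) \<noteq> k ((s + r) / 2)"
  using inj_onD[OF inj_k, of "(s + t) / 2" "(s + r) / 2"] midpoint_mem assms by auto

text \<open>At a fixed midpoint \<open>x\<close>, integrating
  \<open>q (x + h) - q (x - h) = k x * (p (x + h) - p (x - h))\<close> over \<open>h\<close> from 0
  to \<open>a\<close> gives \<open>N x = k x * M x\<close>. The antiderivatives \<open>P\<close> and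
  \<open>Q\<close> are differentiable where \<open>p\<close> and \<open>q\<close> are only known to
  be continuous, so \<open>N / M\<close> is differentiable.\<close>

lemma k_differentiable:
  assumes "m \<in> I"
  shows "k differentiable at m"
proof -
  obtain e where e: "e > 0" "cball m e \<subseteq> I"
    using open_I \<open>m \<in> I\<close> open_contains_cball by blast
  obtain P where P: "\<And>x. x \<in> ball m e \<Longrightarrow> (P has_real_derivative p x) (at x)"
    using antiderivative_ball continuous_on_subset[OF cont_p e(2)] by metis
  obtain Q where Q: "\<And>x. x \<in> ball m e \<Longrightarrow> (Q has_real_derivative q x) (at x)"
    using antiderivative_ball continuous_on_subset[OF cont_q e(2)] by metis
  \<comment> \<open>Half the radius: a centre closer than \<open>a\<close> to \<open>m\<close>,
    moved by at most \<open>a\<close>, stays in \<open>ball m e\<close>.\<close>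
  define a where "a = e / 2"
  have a: "a > 0" using e(1) by (simp add: a_def)
  define M where "M = (\<lambda>x. P (x + a) + P (x - a) - 2 * P x)"
  define N where "N = (\<lambda>x. Q (x + a) + Q (x - a) - 2 * Q x)"
  have k: "M x \<noteq> 0" "k x = N x / M x" if x: "x \<in> ball m a" for x
  proof -
    have in_ball: "x + h \<in> ball m e" "x - h \<in> ball m e" if "0 \<le> h" "h \<le> a" for h
      using that x unfolding a_def mem_ball dist_real_def by linarith+
    have in_I: "x + h \<in> I" "x - h \<in> I" if "0 \<le> h" "h \<le> a" for h
      using in_ball[OF that] e(2) ball_subset_cball by blast+
    have dP: "((\<lambda>h. P (x + h) + P (x - h)) has_real_derivative p (x + h) - p (x - h)) (at h)"
      if "0 \<le> h" "h \<le> a" for h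
      by (rule reflected_difference_deriv(2)[where S = "ball m e", OF P]) (use in_ball[OF that] in auto)
    have dQ: "((\<lambda>h. Q (x + h) + Q (x - h)) has_real_derivative q (x + h) - q (x - h)) (at h)"
      if "0 \<le> h" "h \<le> a" for h
      by (rule reflected_difference_deriv(2)[where S = "ball m e", OF Q]) (use in_ball[OF that] in auto)
    have contP: "continuous_on {0..a} (\<lambda>h. P (x + h) + P (x - h))"
      by (rule DERIV_continuous_on, rule has_field_derivative_at_within, rule dP) auto
    have contQ: "continuous_on {0..a} (\<lambda>h. Q (x + h) + Q (x - h))"
      by (rule DERIV_continuous_on, rule has_field_derivative_at_within, rule dQ) auto
    \<comment> \<open>If \<open>M x\<close> vanished, Rolle's theorem in \<open>h\<close> would give
      some \<open>z\<close> between 0 and \<open>a\<close> with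
      \<open>p (x + z) = p (x - z)\<close>, against injectivity of \<open>p\<close>.\<close>
    show "M x \<noteq> 0"
    proof
      assume "M x = 0"
      then have "P (x + 0) + P (x - 0) = P (x + a) + P (x - a)"
        by (simp add: M_def)
      moreover have "(\<lambda>h. P (x + h) + P (x - h)) differentiable at h" if "0 < h" "h < a" for h
        using dP[of h] that unfolding real_differentiable_def by (intro exI) auto
      ultimately have "\<exists>z>0. z < a \<and> ((\<lambda>h. P (x + h) + P (x - h)) has_real_derivative 0) (at z)"
        using Rolle[OF a _ contP] by simp
      then obtain z where z: "0 < z" "z < a" "((\<lambda>h. P (x + h) + P (x - h)) has_real_derivative 0) (at z)"
        by blast
      then have "p (x + z) - p (x - z) = 0"
        by (intro DERIV_unique[OF dP]) auto
      then show False
        using inj_onD[OF inj_p, of "x + z" "x - z"] in_I[of z] z by auto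
    qed
    \<comment> \<open>The integration over \<open>h\<close>, phrased as constancy on
      \<open>{0..a}\<close> of a function whose derivative vanishes by the midpoint
      equation.\<close>
    have "((\<lambda>h. Q (x + h) + Q (x - h) - k x * (P (x + h) + P (x - h))) has_real_derivative 0) (at h)"
      if "0 \<le> h" "h \<le> a" for h
      using DERIV_diff[OF dQ[OF that] DERIV_cmult[OF dP[OF that], of "k x"]]
        midpoint_eq[OF in_I[OF that]] by simp
    then have "Q (x + a) + Q (x - a) - k x * (P (x + a) + P (x - a))
        = Q (x + 0) + Q (x - 0) - k x * (P (x + 0) + P (x - 0))"
      by (intro DERIV_isconst_end a continuous_intros contP contQ) auto
    then have "N x = k x * M x"
      by (simp add: M_def N_def algebra_simps)
    then show "k x = N x / M x"
      using \<open>M x \<noteq> 0\<close> by simp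
  qed
  have m: "m \<in> ball m a" using a by simp
  have near: "m + a \<in> ball m e" "m - a \<in> ball m e" "m \<in> ball m e"
    using e(1) by (auto simp: a_def dist_real_def)
  have shifted: "((\<lambda>x. F (x + a) + F (x - a) - 2 * F x) has_real_derivative
      f (m + a) + f (m - a) - 2 * f m) (at m)"
    if F: "\<And>x. x \<in> ball m e \<Longrightarrow> (F has_real_derivative f x) (at x)" for F f
  proof -
    have "((\<lambda>x. F (x + a)) has_real_derivative f (m + a)) (at m)"
      using F[OF near(1)] by (simp add: DERIV_shift)
    moreover have "((\<lambda>x. F (x - a)) has_real_derivative f (m - a)) (at m)"
      using F[OF near(2)] DERIV_shift[of F _ m "- a"] by simp
    ultimately show ?thesis
      using F[OF near(3)] by (auto intro!: derivative_eq_intros)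
  qed
  obtain D where "((\<lambda>x. N x / M x) has_real_derivative D) (at m)"
    using DERIV_divide[OF shifted[OF Q, folded N_def] shifted[OF P, folded M_def] k(1)[OF m]] by blast
  then have "(k has_real_derivative D) (at m)"
    by (rule has_field_derivative_transform_within_open[where S = "ball m a"]) (use k(2) m in auto)
  then show ?thesis
    using real_differentiable_def by blast
qed

lemma k_midpoint_differentiable:
  assumes "s \<in> I" "t \<in> I"
  shows "(\<lambda>s. k ((s + t) / 2)) differentiable at s"
proof -
  obtain D where "(k has_real_derivative D) (at ((s + t) / 2))"
    using k_differentiable midpoint_mem assms real_differentiable_def by blast
  then have "((\<lambda>s. k ((s + t) / 2)) has_real_derivative D * (1 / 2)) (at s)"
    by (rule DERIV_chain2[where g = "\<lambda>s. (s + t) / 2"]) (auto intro!: derivative_eq_intros)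
  then show ?thesis
    using real_differentiable_def by blast
qed

text \<open>
  Summing the equation over the pairs \<open>(s, t)\<close>, \<open>(t, r)\<close>, \<open>(r, s)\<close> eliminates \<open>q\<close> and expresses
  \<open>p s\<close> through values of \<open>k\<close> at midpoints, so \<open>p\<close> inherits the regularity of \<open>k\<close>.
\<close>

lemma p_differentiable:
  assumes "s \<in> I"
  shows "p differentiable at s"
proof -
  obtain e where e: "e > 0" "ball s e \<subseteq> I"
    using open_I assms open_contains_ball by blast
  define t where "t = s + e / 2"
  have t: "t \<in> I" "s \<noteq> t"
    using e by (auto simp: t_def dist_real_def subset_iff)
  let ?N = "\<lambda>x. p t * (k ((x + t) / 2) - k ((t + s) / 2)) + p s * (k ((t + s) / 2) - k ((x + s) / 2))"
  let ?M = "\<lambda>x. k ((x + t) / 2) - k ((x + s) / 2)"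
  have M: "?M x \<noteq> 0" if "x \<in> I" for x
    using k_midpoint_neq[of x t s] that t assms by simp
  have p: "?N x / ?M x = p x" if "x \<in> I" for x
  proof -
    have "p x * ?M x = ?N x"
      using midpoint_eq[of x t] midpoint_eq[of t s] midpoint_eq[of x s] that t assms
      by (simp add: algebra_simps)
    then show ?thesis
      using M[OF that] by (simp add: field_simps)
  qed
  have "(\<lambda>x. ?N x / ?M x) differentiable at s"
    using k_midpoint_differentiable assms t M[OF assms] by simp
  then obtain D where "((\<lambda>x. ?N x / ?M x) has_real_derivative D) (at s)"
    using real_differentiable_def by blast
  then have "(p has_real_derivative D) (at s)"
    by (rule has_field_derivative_transform_within_open[where S = I]) (use p open_I assms in auto)
  then show ?thesis
    using real_differentiable_def by blast
qed

lemma q_differentiable: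
  assumes "s \<in> I"
  shows "q differentiable at s"
proof -
  have "(\<lambda>x. q s + k ((x + s) / 2) * (p x - p s)) differentiable at s"
    using k_midpoint_differentiable p_differentiable assms by simp
  then obtain D where "((\<lambda>x. q s + k ((x + s) / 2) * (p x - p s)) has_real_derivative D) (at s)"
    using real_differentiable_def by blast
  then have "(q has_real_derivative D) (at s)"
    by (rule has_field_derivative_transform_within_open[where S = I])
      (use midpoint_eq[of _ s] open_I assms in \<open>auto simp: algebra_simps\<close>)
  then show ?thesis
    using real_differentiable_def by blast
qed

section \<open>The equation for the derivatives\<close>

abbreviation "w \<equiv> deriv p"
abbreviation "v \<equiv> deriv q"

lemma p_deriv: "s \<in> I \<Longrightarrow> (p has_real_derivative w s) (at s)"
  and q_deriv: "s \<in> I \<Longrightarrow> (q has_real_derivative v s) (at s)"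
  using p_differentiable q_differentiable
  by (simp_all add: DERIV_deriv_iff_real_differentiable)

text \<open>Moving \<open>s\<close> and \<open>t\<close> apart symmetrically keeps the midpoint
  \<open>m\<close> fixed, so differentiating in the half-difference \<open>h\<close> treats
  \<open>k m\<close> as a constant and no derivative of \<open>k\<close> appears.\<close>

lemma deriv_sum:
  assumes "s \<in> I" "t \<in> I"
  shows "v s + v t = k ((s + t) / 2) * (w s + w t)"
proof -
  define m h where "m = (s + t) / 2" and "h = (s - t) / 2"
  have st: "m + h = s" "m - h = t" by (auto simp: m_def h_def field_simps)
  have "((\<lambda>h. (q (m + h) - q (m - h)) - k m * (p (m + h) - p (m - h)))
      has_real_derivative (v s + v t) - k m * (w s + w t)) (at h)"
    using DERIV_diff[OF reflected_difference_deriv(1)[where S = I and m = m and h = h, OF q_deriv]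
        DERIV_cmult[OF reflected_difference_deriv(1)[where S = I and m = m and h = h, OF p_deriv],
          where c = "k m"]] assms st
    by simp
  moreover have "((\<lambda>h. (q (m + h) - q (m - h)) - k m * (p (m + h) - p (m - h)))
      has_real_derivative 0) (at h)"
  proof (rule has_field_derivative_transform_within_open)
    show "((\<lambda>h. 0) has_real_derivative 0) (at h)" by simp
    show "open ((\<lambda>h. m + h) -` I \<inter> (\<lambda>h. m - h) -` I)"
      by (intro open_Int open_vimage open_I continuous_intros)
    show "0 = (q (m + x) - q (m - x)) - k m * (p (m + x) - p (m - x))"
      if "x \<in> (\<lambda>h. m + h) -` I \<inter> (\<lambda>h. m - h) -` I" for x
      using midpoint_eq[of "m + x" "m - x"] that by simp
  qed (use assms st in auto)
  ultimately have "(v s + v t) - k m * (w s + w t) = 0"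
    by (rule DERIV_unique)
  then show ?thesis
    by (simp add: m_def)
qed

lemma v_eq: "s \<in> I \<Longrightarrow> v s = k s * w s"
  using deriv_sum[of s s] by simp

text \<open>
  \<open>deriv_sum\<close> is satisfied by \<open>(w, v)\<close>, and also by its symmetric shifts and by the symmetric
  differences of \<open>(p, q)\<close>, because the pairs \<open>(s + a, t - a)\<close> and \<open>(s - a, t + a)\<close> have the same
  midpoint as \<open>(s, t)\<close>. Each solution \<open>(f, k f)\<close> has \<open>f s / f t\<close> determined by \<open>k\<close> alone.
\<close>

lemma balance:
  assumes "f' s = k s * f s" "f' t = k t * f t"
    and "f' s + f' t = k ((s + t) / 2) * (f s + f t)"
  shows "f s * (k s - k ((s + t) / 2)) = f t * (k ((s + t) / 2) - k t)"
  using assms by (simp add: algebra_simps)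

lemma w_balance:
  "s \<in> I \<Longrightarrow> t \<in> I \<Longrightarrow> w s * (k s - k ((s + t) / 2)) = w t * (k ((s + t) / 2) - k t)"
  by (rule balance[where f' = v]) (auto intro: v_eq deriv_sum)

text \<open>Here \<open>f'\<close> is not a derivative but the companion \<open>k f\<close> of
  \<open>f\<close>, as \<open>v\<close> is for \<open>w\<close>. Multiplying the balance of
  \<open>f\<close> by \<open>w t\<close> and inserting that of \<open>w\<close> leaves the common
  factor \<open>k s - k ((s + t) / 2)\<close>, which is nonzero for
  \<open>s \<noteq> t\<close>.\<close>

lemma proportional_to_w:
  assumes st: "s \<in> I" "t \<in> I"
    and f: "f' s = k s * f s" "f' t = k t * f t" "f' s + f' t = k ((s + t) / 2) * (f s + f t)"
  shows "f s * w t = f t * w s"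
proof (cases "s = t")
  case False
  have "k s \<noteq> k ((s + t) / 2)"
    using k_midpoint_neq[of s s t] st False by simp
  moreover have "f s * w t * (k s - k ((s + t) / 2)) = f t * w s * (k s - k ((s + t) / 2))"
    using balance[of f' s f t] w_balance[OF st] f by algebra
  ultimately show ?thesis by simp
qed simp

text \<open>One zero of \<open>w\<close> spreads over all of \<open>I\<close> through
  \<open>w_balance\<close>, since \<open>k\<close> differs at \<open>s\<close> and at the midpoint.
  Then \<open>p\<close> would be constant, against injectivity.\<close>

lemma w_nonzero:
  assumes "t \<in> I"
  shows "w t \<noteq> 0"
proof
  assume "w t = 0"
  have "w s = 0" if "s \<in> I" for s
    using w_balance[OF that assms] k_midpoint_neq[of s s t] that assms \<open>w t = 0\<close> by force
  then have "(p has_real_derivative 0) (at s)" if "s \<in> I" for s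
    using p_deriv[OF that] that by simp
  then obtain c where c: "\<And>s. s \<in> I \<Longrightarrow> p s = c"
    using zero_deriv_constant[OF is_interval_convex[OF interval_I]] by blast
  obtain e where e: "e > 0" "ball t e \<subseteq> I"
    using open_I assms open_contains_ball by blast
  have "t + e / 2 \<in> I"
    using e by (auto simp: dist_real_def subset_iff)
  then show False
    using inj_onD[OF inj_p, of t "t + e / 2"] c assms e(1) by simp
qed

section \<open>Constant ratios and the second order equation\<close>

lemma difference_proportional:
  assumes "s + a \<in> I" "s - a \<in> I" "t + a \<in> I" "t - a \<in> I"
  shows "(p (s + a) - p (s - a)) * w t = (p (t + a) - p (t - a)) * w s"
proof -
  have "s \<in> I" "t \<in> I"
    using midpoint_mem[of "s + a" "s - a"] midpoint_mem[of "t + a" "t - a"] assms by auto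
  then show ?thesis
  proof (rule proportional_to_w[where f' = "\<lambda>s. q (s + a) - q (s - a)"])
    show "q (s + a) - q (s - a) + (q (t + a) - q (t - a))
        = k ((s + t) / 2) * (p (s + a) - p (s - a) + (p (t + a) - p (t - a)))"
      using midpoint_eq[of "s + a" "t - a"] midpoint_eq[of "t + a" "s - a"] assms
      by (simp add: algebra_simps)
  qed (use midpoint_eq[of "s + a" "s - a"] midpoint_eq[of "t + a" "t - a"] assms in auto)
qed

lemma sum_proportional:
  assumes "s + a \<in> I" "s - a \<in> I" "t + a \<in> I" "t - a \<in> I"
  shows "(w (s + a) + w (s - a)) * w t = (w (t + a) + w (t - a)) * w s"
proof -
  have "s \<in> I" "t \<in> I"
    using midpoint_mem[of "s + a" "s - a"] midpoint_mem[of "t + a" "t - a"] assms by auto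
  then show ?thesis
  proof (rule proportional_to_w[where f' = "\<lambda>s. v (s + a) + v (s - a)"])
    show "v (s + a) + v (s - a) + (v (t + a) + v (t - a))
        = k ((s + t) / 2) * (w (s + a) + w (s - a) + (w (t + a) + w (t - a)))"
      using deriv_sum[of "s + a" "t - a"] deriv_sum[of "t + a" "s - a"] assms
      by (simp add: algebra_simps)
  qed (use deriv_sum[of "s + a" "s - a"] deriv_sum[of "t + a" "t - a"] assms in auto)
qed

text \<open>A step size that serves two points at once allows the constants found near each of them
  to be compared.\<close>

lemma common_step:
  assumes "s \<in> I" "t \<in> I"
  obtains a where "a > 0" "s + 2 * a \<in> I" "s - 2 * a \<in> I" "t + 2 * a \<in> I" "t - 2 * a \<in> I"
proof -
  obtain d where d: "d > 0" "ball s d \<subseteq> I"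
    using open_I assms(1) open_contains_ball by blast
  obtain e where e: "e > 0" "ball t e \<subseteq> I"
    using open_I assms(2) open_contains_ball by blast
  show thesis
    by (rule that[of "min d e / 4"]) (use d e in \<open>auto simp: dist_real_def subset_iff\<close>)
qed

text \<open>\<open>L\<close> and \<open>l\<close> are the two constant ratios, read off at the
  reference point \<open>t\<close>. The resulting \<open>c = (l - 2) / L\<^sup>2\<close> may so far
  depend on \<open>a\<close>, and it serves only those \<open>s\<close> that have room for the step
  \<open>2 * a\<close>.\<close>

lemma second_derivatives_at:
  assumes a: "a > 0" and t: "t + 2 * a \<in> I" "t - 2 * a \<in> I"
  obtains c where
    "\<And>s. s + 2 * a \<in> I \<Longrightarrow> s - 2 * a \<in> I \<Longrightarrow> w differentiable at s \<and> v differentiable at s \<and>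
      (deriv w has_real_derivative c * w s) (at s) \<and> (deriv v has_real_derivative c * v s) (at s)"
proof -
  have t1: "t \<in> I" "t + a \<in> I" "t - a \<in> I"
    using t a mem_between[of "t - 2 * a" "t + 2 * a"] by auto
  define L where "L = (p (t + a) - p (t - a)) / w t"
  define l where "l = (w (t + 2 * a) + w (t - 2 * a)) / w t"
  have L: "L \<noteq> 0"
    using inj_onD[OF inj_p, of "t + a" "t - a"] t1 a w_nonzero[of t] by (auto simp: L_def)
  have p: "p (s + a) - p (s - a) = L * w s" if "s + a \<in> I" "s - a \<in> I" for s
    using difference_proportional[of s a t] that t1 w_nonzero[of t] by (simp add: L_def field_simps)
  have w: "w (s + 2 * a) + w (s - 2 * a) = l * w s" if "s + 2 * a \<in> I" "s - 2 * a \<in> I" for s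
    using sum_proportional[of s "2 * a" t] that t t1 w_nonzero[of t] by (simp add: l_def field_simps)
  \<comment> \<open>Shifts symmetric about \<open>s\<close> have midpoint \<open>s\<close>, so
    multiplying the relations for \<open>p\<close> and \<open>w\<close> by \<open>k s\<close> yields
    those for \<open>q\<close> and \<open>v\<close> with the same \<open>L\<close> and
    \<open>l\<close>.\<close>
  have q: "q (s + a) - q (s - a) = L * v s" if "s + a \<in> I" "s - a \<in> I" for s
    using midpoint_eq[OF that] p[OF that] v_eq[of s] midpoint_mem[OF that] by simp
  have v: "v (s + 2 * a) + v (s - 2 * a) = l * v s" if "s + 2 * a \<in> I" "s - 2 * a \<in> I" for s
    using deriv_sum[OF that] w[OF that] v_eq[of s] midpoint_mem[OF that] by simp
  note w_step = two_step_second_derivative[OF open_I interval_I p_deriv p w L a]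
  note v_step = two_step_second_derivative[OF open_I interval_I q_deriv q v L a]
  show thesis
    by (rule that[of "(l - 2) / L\<^sup>2"]) (use w_step v_step in blast)
qed

lemma second_order_equation:
  obtains c where
    "\<And>s. s \<in> I \<Longrightarrow> w differentiable at s \<and> v differentiable at s \<and>
      (deriv w has_real_derivative c * w s) (at s) \<and> (deriv v has_real_derivative c * v s) (at s)"
proof (cases "I = {}")
  case False
  then obtain t where t: "t \<in> I" by blast
  show thesis
  \<comment> \<open>Evaluating the equation for \<open>w\<close> at the fixed point \<open>t\<close>
    identifies the constant for every step size, so it does not change when \<open>a\<close> shrinks
    as \<open>s\<close> nears an endpoint of \<open>I\<close>.\<close>
  proof (rule that[of "deriv (deriv w) t / w t"])
    fix s assume "s \<in> I"
    then obtain a where a: "a > 0" "s + 2 * a \<in> I" "s - 2 * a \<in> I" "t + 2 * a \<in> I" "t - 2 * a \<in> I"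
      using common_step[OF _ t] by metis
    then obtain c where c: "\<And>s. s + 2 * a \<in> I \<Longrightarrow> s - 2 * a \<in> I \<Longrightarrow>
        w differentiable at s \<and> v differentiable at s \<and>
        (deriv w has_real_derivative c * w s) (at s) \<and> (deriv v has_real_derivative c * v s) (at s)"
      using second_derivatives_at[of a t] by metis
    have "deriv (deriv w) t = c * w t"
      using c[of t] a DERIV_imp_deriv by blast
    then have "deriv (deriv w) t / w t = c"
      using w_nonzero[OF t] by simp
    then show "w differentiable at s \<and> v differentiable at s \<and>
        (deriv w has_real_derivative deriv (deriv w) t / w t * w s) (at s) \<and>
        (deriv v has_real_derivative deriv (deriv w) t / w t * v s) (at s)"
      using c[of s] a by simp
  qed
qed (use that in auto)

text \<open>\<open>f\<close> is a combination of \<open>dpsi1\<close> and \<open>dpsi2\<close>, and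
  integrating once gives \<open>F\<close>. It is applied to \<open>p\<close> and to \<open>q\<close>
  with the same \<open>c\<close>.\<close>

lemma psi_representation:
  assumes F: "\<And>s. s \<in> I \<Longrightarrow> (F has_real_derivative f s) (at s)"
    and f: "\<And>s. s \<in> I \<Longrightarrow> f differentiable at s \<and> (deriv f has_real_derivative c * f s) (at s)"
  obtains A B \<mu> where "\<And>s. s \<in> I \<Longrightarrow> F s = A * psi1 c id s + B * psi2 c id s + \<mu>"
proof -
  have conv: "convex I" using interval_I is_interval_convex by blast
  obtain e1 e2 W where d:
    "\<And>s. (dpsi1 c has_real_derivative e1 s) (at s)" "\<And>s. (e1 has_real_derivative c * dpsi1 c s) (at s)"
    "\<And>s. (dpsi2 c has_real_derivative e2 s) (at s)" "\<And>s. (e2 has_real_derivative c * dpsi2 c s) (at s)"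
    "W \<noteq> 0" "\<And>s. dpsi1 c s * e2 s - dpsi2 c s * e1 s = W"
    using dpsi_wronskian[of c] by blast
  have "(f has_real_derivative deriv f s) (at s)" if "s \<in> I" for s
    using f[OF that] DERIV_deriv_iff_real_differentiable by blast
  moreover have "(deriv f has_real_derivative c * f s) (at s)" if "s \<in> I" for s
    using f[OF that] by blast
  ultimately obtain A B where AB: "\<And>s. s \<in> I \<Longrightarrow> f s = A * dpsi1 c s + B * dpsi2 c s"
    using second_order_solution[OF conv _ _ d] by blast
  have "((\<lambda>s. F s - (A * psi1 c id s + B * psi2 c id s)) has_real_derivative 0) (at s)"
    if "s \<in> I" for s
    using DERIV_diff[OF F[OF that]
        DERIV_add[OF DERIV_cmult[OF psi_deriv(1), of A c] DERIV_cmult[OF psi_deriv(2), of B c]]]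
      AB[OF that] by simp
  then obtain \<mu> where "\<And>s. s \<in> I \<Longrightarrow> F s - (A * psi1 c id s + B * psi2 c id s) = \<mu>"
    using zero_deriv_constant[OF conv] by blast
  then have "F s = A * psi1 c id s + B * psi2 c id s + \<mu>" if "s \<in> I" for s
    using that by (simp add: algebra_simps)
  then show thesis by (rule that)
qed

end

section \<open>Cauchy means and differentiability of \<open>\<Phi>\<close>\<close>

text \<open>The mean value theorem and Cauchy's version of it. Membership in the image is what makes
  the \<open>inv_into\<close> of \<open>cauchy_mean\<close> a genuine inverse.\<close>

lemma cauchy_quotient:
  fixes G H :: "real \<Rightarrow> real"
  assumes J: "open J" "is_interval J"
    and dG: "\<And>x. x \<in> J \<Longrightarrow> (G has_real_derivative G' x) (at x)"
    and dH: "\<And>x. x \<in> J \<Longrightarrow> (H has_real_derivative H' x) (at x)"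
    and H': "\<And>x. x \<in> J \<Longrightarrow> H' x \<noteq> 0"
    and xy: "x \<in> J" "y \<in> J" "x \<noteq> y"
  shows "H x \<noteq> H y" and "(G x - G y) / (H x - H y) \<in> (\<lambda>t. G' t / H' t) ` J"
proof -
  have less: "H x \<noteq> H y \<and> (G x - G y) / (H x - H y) \<in> (\<lambda>t. G' t / H' t) ` J"
    if xy: "x \<in> J" "y \<in> J" "y < x" for x y
  proof -
    have in_J: "z \<in> J" if "y \<le> z" "z \<le> x" for z
      using J(2) xy that by (meson mem_is_interval_1_I)
    obtain z where z: "y < z" "z < x" "H x - H y = (x - y) * H' z"
      using MVT2[OF \<open>y < x\<close>, of H H'] dH in_J by blast
    then have "H x \<noteq> H y"
      using H'[of z] in_J[of z] xy by auto
    moreover obtain u where u: "y < u" "u < x" "(G x - G y) * H' u = (H x - H y) * G' u"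
    proof -
      have "\<exists>u>y. u < x \<and> (G x - G y) * H' u = (H x - H y) * G' u"
      proof (rule GMVT'[OF \<open>y < x\<close>])
        show "isCont G z" "isCont H z" if "y \<le> z" "z \<le> x" for z
          using dG[OF in_J[OF that]] dH[OF in_J[OF that]] by (simp_all add: DERIV_isCont)
      qed (use dG dH in_J in auto)
      then show thesis using that by blast
    qed
    ultimately have "(G x - G y) / (H x - H y) = G' u / H' u"
      using H'[of u] in_J[of u] by (simp add: field_simps)
    with \<open>H x \<noteq> H y\<close> in_J[of u] u show ?thesis by auto
  qed
  have "H x \<noteq> H y \<and> (G x - G y) / (H x - H y) \<in> (\<lambda>t. G' t / H' t) ` J"
  proof (cases "y < x")
    case False
    have "(G x - G y) / (H x - H y) = (G y - G x) / (H y - H x)"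
      by (metis minus_diff_eq minus_divide_divide)
    with False less[of y x] xy show ?thesis by auto
  qed (use less xy in blast)
  then show "H x \<noteq> H y" "(G x - G y) / (H x - H y) \<in> (\<lambda>t. G' t / H' t) ` J"
    by auto
qed

text \<open>Caratheodory's form of the derivative gives
  \<open>H y - H x = g (\<Phi> y) * (\<Phi> y - \<Phi> x)\<close> with \<open>g (\<Phi> y)\<close>
  tending to \<open>p' \<noteq> 0\<close>. Dividing by \<open>g (\<Phi> y)\<close> turns the
  difference quotient of \<open>H\<close> into that of \<open>\<Phi>\<close>.\<close>

lemma differentiable_of_composition:
  fixes H p \<Phi> :: "real \<Rightarrow> real"
  assumes J: "open J" "x \<in> J" "continuous_on J \<Phi>" "inj_on \<Phi> J"
    and p: "(p has_real_derivative p') (at (\<Phi> x))" "p' \<noteq> 0"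
    and H: "(H has_real_derivative H') (at x)"
    and comp: "\<And>y. y \<in> J \<Longrightarrow> H y = p (\<Phi> y)"
  shows "(\<Phi> has_real_derivative H' / p') (at x)"
proof -
  obtain g where g: "\<And>z. p z - p (\<Phi> x) = g z * (z - \<Phi> x)" "isCont g (\<Phi> x)" "g (\<Phi> x) = p'"
    using p(1) CARAT_DERIV by metis
  have "isCont \<Phi> x"
    using J continuous_on_eq_continuous_at by blast
  then have "isCont (\<lambda>y. g (\<Phi> y)) x"
    using g(2) isCont_o2 by blast
  then have lim: "(\<lambda>y. g (\<Phi> y)) \<midarrow>x\<rightarrow> p'"
    using g(3) by (simp add: isCont_def)
  have "(\<lambda>y. (H y - H x) / (y - x) / g (\<Phi> y)) \<midarrow>x\<rightarrow> H' / p'"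
    using H lim p(2) by (intro tendsto_divide) (auto simp: has_field_derivative_iff)
  moreover have "\<forall>\<^sub>F y in at x. (H y - H x) / (y - x) / g (\<Phi> y) = (\<Phi> y - \<Phi> x) / (y - x)"
  proof -
    have "\<forall>\<^sub>F y in at x. y \<in> J"
      using J(1,2) by (rule eventually_at_in_open')
    moreover have "\<forall>\<^sub>F y in at x. g (\<Phi> y) \<noteq> 0"
      using lim p(2) by (rule tendsto_imp_eventually_ne)
    ultimately show ?thesis
    proof eventually_elim
      case (elim y)
      then show ?case
        using g(1)[of "\<Phi> y"] comp J(2) by (simp add: divide_simps)
    qed
  qed
  ultimately have "(\<lambda>y. (\<Phi> y - \<Phi> x) / (y - x)) \<midarrow>x\<rightarrow> H' / p'"
    by (rule Lim_transform_eventually)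
  then show ?thesis
    by (simp add: has_field_derivative_iff)
qed

section \<open>The characterization of equality of the two means\<close>

theorem theorem25:
  fixes J :: "real set" and G H \<Phi> :: "real \<Rightarrow> real"
  assumes "J \<noteq> {}" and "open J" and "is_interval J"
    and "G differentiable_on J" and "H differentiable_on J"
    and "0 \<notin> deriv H ` J"
    and "inj_on (\<lambda>t. deriv G t / deriv H t) J"
    and "continuous_on J \<Phi>"
    and "strict_mono_on J \<Phi> \<or> strict_antimono_on J \<Phi>"
  shows "(\<forall>x\<in>J. \<forall>y\<in>J. cauchy_mean J G H x y = quasi_arith_mean J \<Phi> x y) \<longleftrightarrow>
    (\<Phi> differentiable_on J \<and> (\<forall>x\<in>J. deriv \<Phi> x \<noteq> 0) \<and>
     (\<exists>A B C D \<mu> l \<gamma> :: real. A * D \<noteq> B * C \<and>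
       (\<forall>x\<in>J. G x = A * psi1 \<gamma> \<Phi> x + B * psi2 \<gamma> \<Phi> x + \<mu> \<and>
              H x = C * psi1 \<gamma> \<Phi> x + D * psi2 \<gamma> \<Phi> x + l)))"
    (is "?means \<longleftrightarrow> ?repr")
proof -
  define R where "R = (\<lambda>t. deriv G t / deriv H t)"
  define \<phi> where "\<phi> = inv_into J \<Phi>"
  define I where "I = \<Phi> ` J"
  have dG: "(G has_real_derivative deriv G x) (at x)" if "x \<in> J" for x
    using assms(2,4) that by (simp add: DERIV_deriv_iff_real_differentiable differentiable_on_eq_differentiable_at)
  have dH: "(H has_real_derivative deriv H x) (at x)" if "x \<in> J" for x
    using assms(2,5) that by (simp add: DERIV_deriv_iff_real_differentiable differentiable_on_eq_differentiable_at)
  have H': "deriv H x \<noteq> 0" if "x \<in> J" for x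
    using assms(6) that by auto
  have inj_R: "inj_on R J"
    using assms(7) by (simp add: R_def)
  have quotient: "H x \<noteq> H y" "(G x - G y) / (H x - H y) \<in> R ` J"
    if "x \<in> J" "y \<in> J" "x \<noteq> y" for x y
    unfolding R_def
    using cauchy_quotient[where G' = "deriv G" and H' = "deriv H", OF assms(2,3) dG dH H' that]
    by simp_all
  have inj_\<Phi>: "inj_on \<Phi> J"
    using assms(9) by (auto simp: monotone_on_def inj_on_def) (metis less_irrefl linorder_less_linear)+
  have \<phi>: "\<phi> s \<in> J" "\<Phi> (\<phi> s) = s" if "s \<in> I" for s
    using that by (auto simp: \<phi>_def I_def inv_into_into f_inv_into_f)
  have \<phi>_\<Phi>: "\<phi> (\<Phi> x) = x" if "x \<in> J" for x
    using inj_\<Phi> that by (simp add: \<phi>_def)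
  have open_I: "open I"
    unfolding I_def by (rule invariance_of_domain[OF assms(8,2) inj_\<Phi>])
  have interval_I: "is_interval I"
    using assms(3,8) connected_continuous_image unfolding I_def is_interval_connected_1 by blast
  have cont_\<phi>: "continuous_on I \<phi>"
    unfolding I_def by (rule continuous_on_inverse_open[OF assms(2,8)]) (use \<phi>_\<Phi> in auto)
  have \<Phi>_in: "\<Phi> x \<in> I" if "x \<in> J" for x
    using that by (simp add: I_def)
  have mid: "(\<Phi> x + \<Phi> y) / 2 \<in> I" if "x \<in> J" "y \<in> J" for x y
    using interval_I that \<Phi>_in[OF that(1)] \<Phi>_in[OF that(2)]
      convexD[of I "\<Phi> x" "\<Phi> y" "1/2" "1/2"]
    by (auto simp: is_interval_convex_1 add_divide_distrib)
  \<comment> \<open>Injectivity of \<open>R\<close>, with the quotient lying in \<open>R\<close>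
    applied to \<open>J\<close>, removes the inverse of \<open>R\<close>. On the diagonal both sides
    hold trivially.\<close>
  have mean_iff: "cauchy_mean J G H x y = quasi_arith_mean J \<Phi> x y \<longleftrightarrow>
      G x - G y = R (\<phi> ((\<Phi> x + \<Phi> y) / 2)) * (H x - H y)" if xy: "x \<in> J" "y \<in> J" for x y
  proof (cases "x = y")
    case True
    then show ?thesis
      using \<phi>_\<Phi>[OF xy(1)] by (simp add: cauchy_mean_def quasi_arith_mean_def \<phi>_def)
  next
    case False
    let ?Q = "(G x - G y) / (H x - H y)" and ?m = "\<phi> ((\<Phi> x + \<Phi> y) / 2)"
    have Q: "?Q \<in> R ` J" "H x \<noteq> H y"
      using quotient[OF xy False] by simp_all
    have "cauchy_mean J G H x y = quasi_arith_mean J \<Phi> x y \<longleftrightarrow> inv_into J R ?Q = ?m"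
      using False by (simp add: cauchy_mean_def quasi_arith_mean_def \<phi>_def R_def)
    also have "\<dots> \<longleftrightarrow> ?Q = R ?m"
      using Q(1) inj_R \<phi>(1)[OF mid[OF xy]] by (metis f_inv_into_f inv_into_f_f)
    also have "\<dots> \<longleftrightarrow> G x - G y = R ?m * (H x - H y)"
      using Q(2) by (simp add: divide_eq_eq)
    finally show ?thesis .
  qed
  show ?thesis
  proof
    assume means: ?means
    define p where "p = (\<lambda>s. H (\<phi> s))"
    define q where "q = (\<lambda>s. G (\<phi> s))"
    define k where "k = (\<lambda>s. R (\<phi> s))"
    have inj_\<phi>: "inj_on \<phi> I"
      using \<phi>(2) by (metis inj_onI)
    have "inj_on H J"
      using quotient(1) by (meson inj_onI)
    \<comment> \<open>Only continuity of \<open>p\<close> and \<open>q\<close> is available here: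
      \<open>\<Phi>\<close> is merely continuous, so \<open>\<phi>\<close> need not preserve the
      differentiability of \<open>H\<close> and \<open>G\<close>.\<close>
    interpret midpoint_equation I p q k
    proof
      show "continuous_on I p" "continuous_on I q"
        unfolding p_def q_def
        using continuous_on_compose2[OF differentiable_imp_continuous_on[OF assms(4)] cont_\<phi>]
          continuous_on_compose2[OF differentiable_imp_continuous_on[OF assms(5)] cont_\<phi>] \<phi>(1)
        by auto
      show "inj_on p I"
        using \<open>inj_on H J\<close> inj_\<phi> \<phi>(1) by (simp add: p_def inj_on_def)
      show "inj_on k I"
        using inj_R inj_\<phi> \<phi>(1) by (simp add: k_def inj_on_def)
      show "q s - q t = k ((s + t) / 2) * (p s - p t)" if "s \<in> I" "t \<in> I" for s t
        using means mean_iff[of "\<phi> s" "\<phi> t"] \<phi> that by (simp add: p_def q_def k_def)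
    qed (use open_I interval_I in auto)
    obtain \<gamma> where \<gamma>: "\<And>s. s \<in> I \<Longrightarrow> w differentiable at s \<and> v differentiable at s \<and>
        (deriv w has_real_derivative \<gamma> * w s) (at s) \<and> (deriv v has_real_derivative \<gamma> * v s) (at s)"
      using second_order_equation by blast
    obtain C D l where p: "\<And>s. s \<in> I \<Longrightarrow> p s = C * psi1 \<gamma> id s + D * psi2 \<gamma> id s + l"
      using psi_representation[OF p_deriv, where c = \<gamma>] \<gamma> by metis
    obtain A B \<mu> where q: "\<And>s. s \<in> I \<Longrightarrow> q s = A * psi1 \<gamma> id s + B * psi2 \<gamma> id s + \<mu>"
      using psi_representation[OF q_deriv, where c = \<gamma>] \<gamma> by metis
    have H: "H x = C * psi1 \<gamma> \<Phi> x + D * psi2 \<gamma> \<Phi> x + l" if "x \<in> J" for x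
      using p[OF \<Phi>_in[OF that]] \<phi>_\<Phi>[OF that] by (simp add: p_def psi1_def psi2_def)
    have G: "G x = A * psi1 \<gamma> \<Phi> x + B * psi2 \<gamma> \<Phi> x + \<mu>" if "x \<in> J" for x
      using q[OF \<Phi>_in[OF that]] \<phi>_\<Phi>[OF that] by (simp add: q_def psi1_def psi2_def)
    obtain x y where xy: "x \<in> J" "y \<in> J" "x \<noteq> y"
    proof -
      obtain x where "x \<in> J" using assms(1) by blast
      moreover have "x islimpt J"
        using \<open>x \<in> J\<close> assms(2) interior_limit_point interior_open by blast
      ultimately show thesis
        using that unfolding islimpt_def by (metis UNIV_I open_UNIV)
    qed
    \<comment> \<open>A vanishing determinant would make the row of \<open>G\<close> a multiple
      \<open>r\<close> of that of \<open>H\<close>, so \<open>G'/H'\<close> would be constant,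
      against injectivity on two distinct points.\<close>
    have "A * D \<noteq> B * C"
    proof
      assume det: "A * D = B * C"
      \<comment> \<open>Otherwise \<open>H\<close> would be constant, while it separates
        \<open>x\<close> and \<open>y\<close>.\<close>
      have nonzero: "C \<noteq> 0 \<or> D \<noteq> 0"
        using quotient(1)[OF xy] H xy by auto
      obtain r where r: "A = r * C" "B = r * D"
      proof (cases "C = 0")
        case True
        with nonzero det show thesis
          by (intro that[of "B / D"]) auto
      next
        case False
        with det show thesis
          by (intro that[of "A / C"]) (auto simp: field_simps)
      qed
      have "deriv G z = r * deriv H z" if "z \<in> J" for z
      proof -
        have "((\<lambda>x. r * H x + (\<mu> - r * l)) has_real_derivative r * deriv H z) (at z)"
          by (auto intro!: derivative_eq_intros dH[OF that])
        then have "(G has_real_derivative r * deriv H z) (at z)"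
          by (rule has_field_derivative_transform_within_open[OF _ assms(2) that])
            (simp add: G H r algebra_simps)
        then show ?thesis by (rule DERIV_imp_deriv)
      qed
      then have "R x = R y"
        using xy H' by (simp add: R_def)
      then show False
        using inj_onD[OF inj_R] xy by blast
    qed
    \<comment> \<open>On \<open>J\<close> one has \<open>H = p \<circ> \<Phi>\<close> with
      \<open>p' = w\<close> free of zeros, so \<open>\<Phi>\<close> inherits a derivative from
      \<open>H\<close>; it is nonzero because \<open>H'\<close> is.\<close>
    moreover have d\<Phi>: "(\<Phi> has_real_derivative deriv H x / w (\<Phi> x)) (at x)" if "x \<in> J" for x
      by (rule differentiable_of_composition[OF assms(2) that assms(8) inj_\<Phi> p_deriv w_nonzero dH])
        (use that \<Phi>_in \<phi>_\<Phi> in \<open>auto simp: p_def\<close>)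
    then have "\<Phi> differentiable_on J"
      using real_differentiable_def differentiable_at_imp_differentiable_on by blast
    moreover have "deriv \<Phi> x \<noteq> 0" if "x \<in> J" for x
      using DERIV_imp_deriv[OF d\<Phi>[OF that]] H'[OF that] w_nonzero[OF \<Phi>_in[OF that]] by simp
    ultimately show ?repr
      using G H by blast
  next
    assume ?repr
    then obtain A B C D \<mu> l \<gamma> where \<Phi>: "\<Phi> differentiable_on J"
      and G: "\<And>x. x \<in> J \<Longrightarrow> G x = A * psi1 \<gamma> \<Phi> x + B * psi2 \<gamma> \<Phi> x + \<mu>"
      and H: "\<And>x. x \<in> J \<Longrightarrow> H x = C * psi1 \<gamma> \<Phi> x + D * psi2 \<gamma> \<Phi> x + l"
      by blast
    have psi_comp: "psi1 \<gamma> \<Phi> x = psi1 \<gamma> id (\<Phi> x)" "psi2 \<gamma> \<Phi> x = psi2 \<gamma> id (\<Phi> x)" for x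
      by (simp_all add: psi1_def psi2_def)
    have deriv_comb: "deriv F x = (a * dpsi1 \<gamma> (\<Phi> x) + b * dpsi2 \<gamma> (\<Phi> x)) * deriv \<Phi> x"
      if x: "x \<in> J" and F: "\<And>x. x \<in> J \<Longrightarrow> F x = a * psi1 \<gamma> \<Phi> x + b * psi2 \<gamma> \<Phi> x + c" for F a b c x
    proof -
      have "(\<Phi> has_real_derivative deriv \<Phi> x) (at x)"
        using \<Phi> x assms(2) by (simp add: DERIV_deriv_iff_real_differentiable differentiable_on_eq_differentiable_at)
      note d = DERIV_chain2[OF psi_deriv(1) this, of \<gamma>] DERIV_chain2[OF psi_deriv(2) this, of \<gamma>]
      have "((\<lambda>x. a * psi1 \<gamma> id (\<Phi> x) + b * psi2 \<gamma> id (\<Phi> x) + c) has_real_derivative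
          a * (dpsi1 \<gamma> (\<Phi> x) * deriv \<Phi> x) + b * (dpsi2 \<gamma> (\<Phi> x) * deriv \<Phi> x) + 0) (at x)"
        by (intro DERIV_add DERIV_cmult DERIV_const d)
      then have "(F has_real_derivative
          a * (dpsi1 \<gamma> (\<Phi> x) * deriv \<Phi> x) + b * (dpsi2 \<gamma> (\<Phi> x) * deriv \<Phi> x) + 0) (at x)"
        by (rule has_field_derivative_transform_within_open[OF _ assms(2) x]) (simp add: F psi_comp)
      then show ?thesis
        by (subst DERIV_imp_deriv) (auto simp: algebra_simps)
    qed
    show ?means
    proof (intro ballI)
      fix x y assume xy: "x \<in> J" "y \<in> J"
      define m where "m = \<phi> ((\<Phi> x + \<Phi> y) / 2)"
      have m: "m \<in> J" "\<Phi> m = (\<Phi> x + \<Phi> y) / 2"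
        using \<phi>[OF mid[OF xy]] by (simp_all add: m_def)
      define d1 d2 where "d1 = dpsi1 \<gamma> (\<Phi> m)" and "d2 = dpsi2 \<gamma> (\<Phi> m)"
      obtain L where L: "psi1 \<gamma> \<Phi> x - psi1 \<gamma> \<Phi> y = L * d1" "psi2 \<gamma> \<Phi> x - psi2 \<gamma> \<Phi> y = L * d2"
        using psi_symmetric_difference[of \<gamma> "\<Phi> x" "\<Phi> y"]
        unfolding psi_comp d1_def d2_def m(2) by blast
      have dG: "deriv G m = (A * d1 + B * d2) * deriv \<Phi> m"
        unfolding d1_def d2_def by (rule deriv_comb[where F = G and c = \<mu>, OF m(1) G])
      have dH: "deriv H m = (C * d1 + D * d2) * deriv \<Phi> m"
        unfolding d1_def d2_def by (rule deriv_comb[where F = H and c = l, OF m(1) H])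
      \<comment> \<open>Since \<open>deriv H m \<noteq> 0\<close>, both
        \<open>C * d1 + D * d2\<close> and \<open>deriv \<Phi> m\<close> are nonzero, and the common
        factor \<open>deriv \<Phi> m\<close> cancels from the quotient.\<close>
      have "R m * (C * d1 + D * d2) = A * d1 + B * d2"
        using H'[OF m(1)] unfolding R_def dG dH by simp
      moreover have "H x - H y = (C * d1 + D * d2) * L"
        unfolding H[OF xy(1)] H[OF xy(2)] using L by algebra
      moreover have "G x - G y = (A * d1 + B * d2) * L"
        unfolding G[OF xy(1)] G[OF xy(2)] using L by algebra
      ultimately have "G x - G y = R m * (H x - H y)"
        by simp
      then show "cauchy_mean J G H x y = quasi_arith_mean J \<Phi> x y"
        unfolding mean_iff[OF xy] m_def .
    qed
  qed
qed

end
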